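(* For any infinite cardinal $\mu$, the class of $\mu$-hypotopologies is not simple.
   Context: Filters. For a set $X$, $\mathbb{F}X$ is the set of proper filters on $X$, ordered by inclusion ($\mathcal{F}\le\mathcal{G}$ iff $\mathcal{F}\subset\mathcal{G}$). Two filters $\mathcal{F},\mathcal{G}$ on $X$ mesh, written $\mathcal{F}\#\mathcal{G}$, if $F\cap G\neq\emptyset$ for all $F\in\mathcal{F}$, $G\in\mathcal{G}$. For $x\in X$, $\{x\}^{\uparrow}$ is the principal ultrafilter of $x$. For $f:X\to Y$ and a filter $\mathcal{F}$ on $X$, $f[\mathcal{F}]=\{B\subset Y: f^{-1}(B)\in\mathcal{F}\}$. A filter $\mathcal{H}$ is $\mu$-complete if $\bigcap\mathcal{H}'\in\mathcal{H}$ for every $\mathcal{H}'\subset\mathcal{H}$ with $|\mathcal{H}'|<\mu$. Convergences. A convergence $\xi$ on a set $X=|\xi|$ is a relation between points $x\in X$ and filters $\mathcal{F}\in\mathbb{F}X$, written $x\in\lim_{\xi}\mathcal{F}$, such that $x\in\lim_\xi\{x\}^{\uparrow}$ for all $x\in X$, and $\lim_\xi\mathcal{F}\subset\lim_\xi\mathcal{G}$ whenever $\mathcal{F}\le\mathcal{G}$. For $f:X\to|\tau|$, $f^{-}\tau$ is the initial convergence on $X$: $x\in\lim_{f^{-}\tau}\mathcal{F}$ iff $f(x)\in\lim_\tau f[\mathcal{F}]$. For a family $\Xi$ of convergences on $X$, $\lim_{\bigvee\Xi}\mathcal{F}=\bigcap_{\xi\in\Xi}\lim_\xi\mathcal{F}$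 (the empty supremum being the antidiscrete convergence, in which every filter converges to every point). The adherence of a filter $\mathcal{H}$ on $|\xi|$ is $\operatorname{adh}_\xi\mathcal{H}=\bigcup\{\lim_\xi\mathcal{G}:\mathcal{G}\in\mathbb{F}|\xi|,\ \mathcal{G}\ge\mathcal{H}\}$. A convergence $\xi$ is a $\mu$-hypotopology if $x\in\lim_\xi\mathcal{F}$ whenever $x\in\operatorname{adh}_\xi\mathcal{D}$ for each $\mu$-complete filter $\mathcal{D}$ on $|\xi|$ with $\mathcal{D}\#\mathcal{F}$. Simplicity. A convergence $\eta$ is initially dense in a class $\Phi$ of convergences if $\eta\in\Phi$ and for every $\xi\in\Phi$ there is a set $A$ of maps from $|\xi|$ to $|\eta|$ with $\xi=\bigvee_{f\in A}f^{-}\eta$. A class $\Phi$ of convergences is simple if it includes a convergence that is initially dense in $\Phi$. *)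

theory Defs
  imports Complex_Main "HOL-Library.FuncSet"
begin

text \<open>
  A proper filter on a subset \<open>X\<close> of a type is a library filter \<open>F \<noteq> bot\<close> with
  \<open>F \<le> principal X\<close>. The library orders filters by reverse inclusion of their families of sets:
  \<open>G \<le> F\<close> says that every member of \<open>F\<close> is a member of \<open>G\<close>, so \<open>G\<close> is the finer filter.
  The image of \<open>F\<close> under a map \<open>f\<close> is \<open>filtermap f F\<close>.
\<close>

definition proper_filters :: "'a set \<Rightarrow> 'a filter set" where
  "proper_filters X = {F. F \<noteq> bot \<and> F \<le> principal X}"

definition mesh :: "'a filter \<Rightarrow> 'a filter \<Rightarrow> bool" where
  "mesh F G \<longleftrightarrow>
    (\<forall>A B. eventually (\<lambda>x. x \<in> A) F \<longrightarrow> eventually (\<lambda>x. x \<in> B) G \<longrightarrow> A \<inter> B \<noteq> {})"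

text \<open>
  A cardinal is given by a well-order \<open>\<mu>\<close> satisfying \<open>Card_order\<close>, on any type. For
  \<open>\<H> = {}\<close> the intersection is \<open>UNIV\<close>, which belongs to every filter.
\<close>

definition card_complete :: "'m rel \<Rightarrow> 'a filter \<Rightarrow> bool" where
  "card_complete \<mu> D \<longleftrightarrow>
    (\<forall>\<H>. (\<forall>A\<in>\<H>. eventually (\<lambda>x. x \<in> A) D) \<longrightarrow> (card_of \<H>, \<mu>) \<in> ordLess
       \<longrightarrow> eventually (\<lambda>x. x \<in> \<Inter>\<H>) D)"

text \<open>
  Only the values of \<open>limits\<close> on the proper filters on \<open>points\<close> carry information; the predicate
  \<open>is_convergence\<close> fixes the other values to be empty, so that equality of convergences is
  equality of the underlying sets and of the convergence relations.
\<close>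

datatype 'a convergence =
  Convergence (points: "'a set") (limits: "'a filter \<Rightarrow> 'a set")

definition is_convergence :: "'a convergence \<Rightarrow> bool" where
  "is_convergence \<xi> \<longleftrightarrow>
    (\<forall>F. limits \<xi> F \<subseteq> points \<xi>) \<and>
    (\<forall>F. F \<notin> proper_filters (points \<xi>) \<longrightarrow> limits \<xi> F = {}) \<and>
    (\<forall>x\<in>points \<xi>. x \<in> limits \<xi> (principal {x})) \<and>
    (\<forall>F\<in>proper_filters (points \<xi>). \<forall>G\<in>proper_filters (points \<xi>).
       G \<le> F \<longrightarrow> limits \<xi> F \<subseteq> limits \<xi> G)"

definition initial_convergence :: "'a set \<Rightarrow> ('a \<Rightarrow> 'b) \<Rightarrow> 'b convergence \<Rightarrow> 'a convergence" where
  "initial_convergence X f \<tau> =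
    Convergence X (\<lambda>F. {x \<in> X. F \<in> proper_filters X \<and> f x \<in> limits \<tau> (filtermap f F)})"

text \<open>The set \<open>X\<close> is an argument because the supremum of the empty family is antidiscrete on it.\<close>

definition sup_convergence :: "'a set \<Rightarrow> 'a convergence set \<Rightarrow> 'a convergence" where
  "sup_convergence X \<Xi> =
    Convergence X (\<lambda>F. {x \<in> X. F \<in> proper_filters X \<and> (\<forall>\<xi>\<in>\<Xi>. x \<in> limits \<xi> F)})"

definition adherence :: "'a convergence \<Rightarrow> 'a filter \<Rightarrow> 'a set" where
  "adherence \<xi> H = (\<Union>G\<in>{G \<in> proper_filters (points \<xi>). G \<le> H}. limits \<xi> G)"

definition hypotopology :: "'m rel \<Rightarrow> 'a convergence \<Rightarrow> bool" where
  "hypotopology \<mu> \<xi> \<longleftrightarrow> is_convergence \<xi> \<and>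
    (\<forall>F\<in>proper_filters (points \<xi>). \<forall>x\<in>points \<xi>.
       (\<forall>D\<in>proper_filters (points \<xi>). card_complete \<mu> D \<longrightarrow> mesh D F \<longrightarrow> x \<in> adherence \<xi> D)
       \<longrightarrow> x \<in> limits \<xi> F)"

definition hypotopologies :: "'m rel \<Rightarrow> 'a convergence set" where
  "hypotopologies \<mu> = {\<xi>. hypotopology \<mu> \<xi>}"

text \<open>
  A proper class of convergences has members on sets of every size, hence on every type, and HOL
  cannot quantify over types inside a formula. The next two notions therefore take two instances
  of the class: \<open>\<Phi>\<close>, its members on subsets of \<open>'a\<close>, where \<open>\<eta>\<close> lives, and \<open>\<Psi>\<close>, its members on
  subsets of \<open>'b\<close>, which \<open>\<eta>\<close> has to generate. A class is simple iff there are a type \<open>'a\<close> and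
  a single \<open>\<eta>\<close> in \<open>\<Phi>\<close> that is initially dense for every type \<open>'b\<close>. It is thus not
  simple as soon as every \<open>'a\<close> admits some \<open>'b\<close> for which \<open>simple_class \<Phi> \<Psi>\<close> fails.
\<close>

definition initially_dense ::
  "'a convergence set \<Rightarrow> 'b convergence set \<Rightarrow> 'a convergence \<Rightarrow> bool" where
  "initially_dense \<Phi> \<Psi> \<eta> \<longleftrightarrow> \<eta> \<in> \<Phi> \<and>
    (\<forall>\<xi>\<in>\<Psi>. \<exists>A. A \<subseteq> (points \<xi> \<rightarrow> points \<eta>) \<and>
       \<xi> = sup_convergence (points \<xi>) ((\<lambda>f. initial_convergence (points \<xi>) f \<eta>) ` A))"

definition simple_class :: "'a convergence set \<Rightarrow> 'b convergence set \<Rightarrow> bool" where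
  "simple_class \<Phi> \<Psi> \<longleftrightarrow> (\<exists>\<eta>. initially_dense \<Phi> \<Psi> \<eta>)"

end

theory Submission imports Defs begin

text \<open>
  Every candidate \<open>\<eta>\<close> for an initially dense hypotopology fails to generate a
  suitable space that is much larger than its set of points. On a type with more than
  \<open>|K|\<close> elements, \<open>K\<close> infinite, call a set small if its cardinality is at
  most \<open>|K|\<close>, and let a filter converge to every point if it has a small member, and to
  no point otherwise. The proper filters that do not converge are precisely those that mesh with the
  filter \<open>H\<close> of complements of small sets. If \<open>\<mu> \<le> |K|\<close>, this
  \<open>H\<close> is \<open>\<mu>\<close>-complete, because small sets are closed under unions of
  at most \<open>|K|\<close> members; as \<open>H\<close> has empty adherence, it witnesses that the
  space is a \<open>\<mu>\<close>-hypotopology (\<open>small_convergence_hypotopology\<close>).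

  Continuous maps \<open>f\<close> into a hypotopology \<open>\<eta>\<close> with at most
  \<open>|K|\<close> points cannot detect that \<open>H\<close> diverges
  (\<open>co_small_image_converges\<close>). The reason is that a section of \<open>f\<close> picks
  out a small set \<open>S\<close> whose image is the whole range of \<open>f\<close>. Any filter
  \<open>D\<close> that meshes with the image of \<open>H\<close> meshes with this range, so the
  preimage of \<open>D\<close> has a proper trace on \<open>S\<close>. The trace converges, since it
  has the small member \<open>S\<close>, and its image is finer than \<open>D\<close>; hence all
  values of \<open>f\<close> adhere to \<open>D\<close>, and they are limits of the image of
  \<open>H\<close> because \<open>\<eta>\<close> is a hypotopology. Thus \<open>H\<close> converges
  in every supremum of initial convergences along continuous maps into \<open>\<eta>\<close>, and
  none of these suprema is the given space. With \<open>K\<close> the type \<open>'a + 'm\<close>,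
  Cantor's theorem makes its powerset large enough.
\<close>

unbundle cardinal_syntax

definition co_small :: "'k set \<Rightarrow> 'b filter" where
  "co_small K = Abs_filter (\<lambda>P. |{x. \<not> P x}| \<le>o |K| )"

lemma eventually_co_small:
  assumes "infinite K"
  shows "eventually P (co_small K) \<longleftrightarrow> |{x. \<not> P x}| \<le>o |K|"
  unfolding co_small_def
proof (rule eventually_Abs_filter, rule is_filter.intro)
  show "|{x. \<not> True}| \<le>o |K|"
    by (simp add: card_of_empty)
next
  fix P Q :: "'b \<Rightarrow> bool"
  assume "|{x. \<not> P x}| \<le>o |K|" and "|{x. \<not> Q x}| \<le>o |K|"
  then have "|{x. \<not> P x} \<union> {x. \<not> Q x}| \<le>o |K|"
    using assms
    by (intro card_of_Un_ordLeq_infinite_Field) (simp_all add: Field_card_of card_of_card_order_on)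
  moreover have "{x. \<not> (P x \<and> Q x)} = {x. \<not> P x} \<union> {x. \<not> Q x}"
    by blast
  ultimately show "|{x. \<not> (P x \<and> Q x)}| \<le>o |K|"
    by simp
next
  fix P Q :: "'b \<Rightarrow> bool"
  assume "\<forall>x. P x \<longrightarrow> Q x" and P: "|{x. \<not> P x}| \<le>o |K|"
  then have "{x. \<not> Q x} \<subseteq> {x. \<not> P x}"
    by blast
  then show "|{x. \<not> Q x}| \<le>o |K|"
    using P by (rule ordLeq_transitive[OF card_of_mono1])
qed

lemma eventually_mem_co_small:
  assumes "infinite K"
  shows "eventually (\<lambda>x. x \<in> A) (co_small K) \<longleftrightarrow> |- A| \<le>o |K|"
  using eventually_co_small[OF assms, of "\<lambda>x. x \<in> A"] by (simp add: Compl_eq)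

lemma co_small_neq_bot:
  assumes "infinite K" and "|K| <o |UNIV :: 'b set|"
  shows "(co_small K :: 'b filter) \<noteq> bot"
proof
  assume "(co_small K :: 'b filter) = bot"
  then have "|UNIV :: 'b set| \<le>o |K|"
    using eventually_co_small[OF assms(1), of "\<lambda>_ :: 'b. False"] by simp
  then show False
    using assms(2) not_ordLess_ordLeq by blast
qed

lemma co_small_card_complete:
  assumes K: "infinite K" and \<mu>: "\<mu> \<le>o |K|"
  shows "card_complete \<mu> (co_small K :: 'b filter)"
  unfolding card_complete_def
proof (intro allI impI)
  fix \<H> :: "'b set set"
  assume mem: "\<forall>A\<in>\<H>. eventually (\<lambda>x. x \<in> A) (co_small K)" and "|\<H>| <o \<mu>"
  then have "|\<H>| \<le>o |K|"
    using \<mu> ordLess_imp_ordLeq ordLess_ordLeq_trans by blast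
  then have "|\<Union>A\<in>\<H>. - A| \<le>o |K|"
    using mem K by (intro card_of_UNION_ordLeq_infinite) (auto simp: eventually_mem_co_small)
  moreover have "(\<Union>A\<in>\<H>. - A) = - \<Inter>\<H>"
    by blast
  ultimately show "eventually (\<lambda>x. x \<in> \<Inter>\<H>) (co_small K)"
    by (simp only: eventually_mem_co_small[OF K])
qed

definition small_convergence :: "'k set \<Rightarrow> 'b convergence" where
  "small_convergence K = Convergence UNIV
    (\<lambda>F. {x. F \<noteq> bot \<and> (\<exists>S. |S| \<le>o |K| \<and> eventually (\<lambda>x. x \<in> S) F)})"

lemma points_small_convergence [simp]: "points (small_convergence K) = UNIV"
  by (simp add: small_convergence_def)

lemma in_limits_small_convergence:
  "x \<in> limits (small_convergence K) F \<longleftrightarrow>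
    F \<noteq> bot \<and> (\<exists>S. |S| \<le>o |K| \<and> eventually (\<lambda>x. x \<in> S) F)"
  by (simp add: small_convergence_def)

lemma mem_proper_filters_UNIV: "F \<in> proper_filters UNIV \<longleftrightarrow> F \<noteq> bot"
  by (simp add: proper_filters_def)

text \<open>
  A filter with a small member \<open>S\<close> cannot be finer than a filter containing the complement of \<open>S\<close>.
\<close>

lemma co_small_adherence:
  assumes "infinite K"
  shows "adherence (small_convergence K) (co_small K) = {}"
proof -
  have False if G: "G \<noteq> bot" "G \<le> co_small K" and S: "|S| \<le>o |K|" "eventually (\<lambda>x. x \<in> S) G"
    for G :: "'b filter" and S
  proof -
    have "eventually (\<lambda>x. x \<in> - S) G"
      using S(1) by (intro filter_leD[OF G(2)])
        (simp only: eventually_mem_co_small[OF assms] double_compl)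
    then have "eventually (\<lambda>x. False) G"
      using S(2) by eventually_elim simp
    then show False
      using G(1) by (simp add: trivial_limit_def)
  qed
  then show ?thesis
    by (fastforce simp: adherence_def in_limits_small_convergence mem_proper_filters_UNIV)
qed

lemma not_mesh_co_small:
  assumes "infinite K" and "\<not> mesh (co_small K) F"
  obtains S where "|S| \<le>o |K|" and "eventually (\<lambda>x. x \<in> S) F"
proof -
  obtain A S where A: "eventually (\<lambda>x. x \<in> A) (co_small K)" and S: "eventually (\<lambda>x. x \<in> S) F"
    and "A \<inter> S = {}"
    using assms(2) by (auto simp: mesh_def)
  then have "S \<subseteq> - A"
    by blast
  then have "|S| \<le>o |K|"
    using A assms(1) by (simp add: eventually_mem_co_small ordLeq_transitive[OF card_of_mono1])
  then show thesis
    using S that by blast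
qed

lemma small_convergence_is_convergence:
  assumes "infinite K"
  shows "is_convergence (small_convergence K :: 'b convergence)"
  unfolding is_convergence_def
proof (intro conjI ballI allI impI)
  fix x :: 'b
  have "|{x}| \<le>o |K|"
    using assms by (intro card_of_singl_ordLeq) auto
  then show "x \<in> limits (small_convergence K) (principal {x})"
    by (auto simp: in_limits_small_convergence eventually_principal principal_eq_bot_iff)
next
  fix F G :: "'b filter"
  assume "G \<in> proper_filters (points (small_convergence K))" and "G \<le> F"
  then show "limits (small_convergence K) F \<subseteq> limits (small_convergence K) G"
    unfolding subset_iff in_limits_small_convergence
    by (metis filter_leD mem_proper_filters_UNIV points_small_convergence)
qed (auto simp: in_limits_small_convergence mem_proper_filters_UNIV)

text \<open>
  The single test filter \<open>co_small K\<close> suffices: it adheres to no point, so a filter that meets the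
  hypotopology condition cannot mesh with it, and therefore has a small member.
\<close>

lemma small_convergence_hypotopology:
  assumes "infinite K" and "\<mu> \<le>o |K|" and "|K| <o |UNIV :: 'b set|"
  shows "hypotopology \<mu> (small_convergence K :: 'b convergence)"
  unfolding hypotopology_def
proof (intro conjI ballI impI)
  show "is_convergence (small_convergence K :: 'b convergence)"
    using assms(1) by (rule small_convergence_is_convergence)
next
  fix F :: "'b filter" and x
  assume F: "F \<in> proper_filters (points (small_convergence K))"
    and adh: "\<forall>D\<in>proper_filters (points (small_convergence K)). card_complete \<mu> D \<longrightarrow>
      mesh D F \<longrightarrow> x \<in> adherence (small_convergence K) D"
  have "\<not> mesh (co_small K) F"
  proof
    assume "mesh (co_small K) F"
    moreover have "co_small K \<in> proper_filters (points (small_convergence K :: 'b convergence))"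
      using co_small_neq_bot[OF assms(1,3)] by (simp add: mem_proper_filters_UNIV)
    ultimately have "x \<in> adherence (small_convergence K) (co_small K)"
      using adh co_small_card_complete[OF assms(1,2)] by blast
    then show False
      by (simp add: co_small_adherence[OF assms(1)])
  qed
  then obtain S where "|S| \<le>o |K|" and "eventually (\<lambda>x. x \<in> S) F"
    by (rule not_mesh_co_small[OF assms(1)])
  then show "x \<in> limits (small_convergence K) F"
    using F by (auto simp: in_limits_small_convergence mem_proper_filters_UNIV)
qed

lemma filtermap_proper:
  assumes "F \<noteq> bot" and "range f \<subseteq> X"
  shows "filtermap f F \<in> proper_filters X"
  using assms
  by (auto simp: proper_filters_def filtermap_bot_iff le_principal eventually_filtermap
      intro!: always_eventually)

text \<open>
  A continuous map (hypothesis \<open>cont\<close>) with few values takes all its values on some small set,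
  and proper filters containing a small set converge. This makes every value of \<open>f\<close> adhere to
  each filter that meshes with the image filter.
\<close>

lemma co_small_image_converges:
  fixes f :: "'b \<Rightarrow> 'a"
  assumes \<eta>: "hypotopology \<mu> \<eta>" and f: "range f \<subseteq> points \<eta>"
    and K: "infinite K" and small: "|points \<eta>| \<le>o |K|" and large: "|K| <o |UNIV :: 'b set|"
    and cont: "\<And>F y. y \<in> limits (small_convergence K) F \<Longrightarrow> f y \<in> limits \<eta> (filtermap f F)"
  shows "f y \<in> limits \<eta> (filtermap f (co_small K))"
proof -
  have "f y \<in> adherence \<eta> D" if meshD: "mesh D (filtermap f (co_small K))" for D
  proof -
    \<comment> \<open>one preimage of each value: small, yet with full image\<close>
    define S where "S = inv f ` range f"
    have fS: "f ` S = range f"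
      by (auto simp: S_def image_image f_inv_into_f)
    have "|S| \<le>o |K|"
      unfolding S_def using f small
      by (meson card_of_image card_of_mono1 ordLeq_transitive)
    \<comment> \<open>the trace on \<open>S\<close> of the preimage of \<open>D\<close>\<close>
    define F where "F = inf (filtercomap f D) (principal S)"
    have "F \<noteq> bot"
    proof
      assume "F = bot"
      then obtain P where P: "eventually P D" and PS: "\<And>x. P (f x) \<Longrightarrow> x \<notin> S"
        by (auto simp: F_def trivial_limit_def eventually_inf_principal eventually_filtercomap)
      have "{z. P z} \<inter> range f \<noteq> {}"
        using meshD P by (simp add: mesh_def eventually_filtermap)
      then show False
        using PS fS by (metis (no_types, lifting) disjoint_iff imageE mem_Collect_eq)
    qed
    moreover have "eventually (\<lambda>x. x \<in> S) F"
      by (simp add: F_def eventually_inf_principal)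
    ultimately have "f y \<in> limits \<eta> (filtermap f F)"
      using \<open>|S| \<le>o |K|\<close> by (intro cont) (auto simp: in_limits_small_convergence)
    moreover have "filtermap f F \<le> D"
      by (simp add: F_def filtermap_le_iff_le_filtercomap)
    moreover have "filtermap f F \<in> proper_filters (points \<eta>)"
      using \<open>F \<noteq> bot\<close> f by (rule filtermap_proper)
    ultimately show ?thesis
      by (auto simp: adherence_def)
  qed
  moreover have "filtermap f (co_small K) \<in> proper_filters (points \<eta>)"
    using co_small_neq_bot[OF K large] f by (rule filtermap_proper)
  moreover have "f y \<in> points \<eta>"
    using f by blast
  ultimately show ?thesis
    using \<eta> unfolding hypotopology_def by blast
qed

theorem theorem13:
  fixes \<mu> :: "'m rel"
  assumes "Card_order \<mu>" and "infinite (Field \<mu>)"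
  shows "\<not> simple_class (hypotopologies \<mu> :: 'a convergence set)
            (hypotopologies \<mu> :: ('a + 'm) set convergence set)"
proof
  define K where "K = (UNIV :: ('a + 'm) set)"
  define \<xi> where "\<xi> = (small_convergence K :: ('a + 'm) set convergence)"
  define H where "H = (co_small K :: ('a + 'm) set filter)"
  assume "simple_class (hypotopologies \<mu> :: 'a convergence set)
    (hypotopologies \<mu> :: ('a + 'm) set convergence set)"
  then obtain \<eta> :: "'a convergence"
    where dense: "initially_dense (hypotopologies \<mu>)
      (hypotopologies \<mu> :: ('a + 'm) set convergence set) \<eta>"
    by (auto simp: simple_class_def)
  have "infinite (UNIV :: 'm set)"
    using assms(2) by (rule infinite_super[OF subset_UNIV])
  then have K: "infinite K"
    by (simp add: K_def)
  have "\<mu> =o |Field \<mu>|"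
    using assms(1) card_of_Field_ordIso ordIso_symmetric by blast
  moreover have "|Field \<mu>| \<le>o |K|"
    by (rule card_of_ordLeqI[of "Inr :: 'm \<Rightarrow> 'a + 'm"]) (auto simp: K_def)
  ultimately have \<mu>: "\<mu> \<le>o |K|"
    by (rule ordIso_ordLeq_trans)
  have small: "|points \<eta>| \<le>o |K|"
    by (rule card_of_ordLeqI[of "Inl :: 'a \<Rightarrow> 'a + 'm"]) (auto simp: K_def)
  have large: "|K| <o |UNIV :: ('a + 'm) set set|"
    using card_of_Pow[of K] by (simp add: K_def)
  have "\<xi> \<in> hypotopologies \<mu>"
    unfolding \<xi>_def hypotopologies_def using small_convergence_hypotopology[OF K \<mu> large] by simp
  then obtain A where A: "A \<subseteq> (points \<xi> \<rightarrow> points \<eta>)"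
    and sup: "\<xi> = sup_convergence (points \<xi>) ((\<lambda>f. initial_convergence (points \<xi>) f \<eta>) ` A)"
    using dense unfolding initially_dense_def by blast
  have points_\<xi>: "points \<xi> = UNIV"
    by (simp add: \<xi>_def)
  have limits_\<xi>: "y \<in> limits \<xi> F \<longleftrightarrow> F \<noteq> bot \<and> (\<forall>f\<in>A. f y \<in> limits \<eta> (filtermap f F))" for y F
    using arg_cong[OF sup, of "\<lambda>\<zeta>. y \<in> limits \<zeta> F"] unfolding points_\<xi>
    by (auto simp: sup_convergence_def initial_convergence_def mem_proper_filters_UNIV)
  have "H \<noteq> bot"
    unfolding H_def using K large by (rule co_small_neq_bot)
  moreover have "f y \<in> limits \<eta> (filtermap f H)" if "f \<in> A" for f y
    unfolding H_def
  proof (rule co_small_image_converges[OF _ _ K small large])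
    show "hypotopology \<mu> \<eta>"
      using dense by (simp add: initially_dense_def hypotopologies_def)
    show "range f \<subseteq> points \<eta>"
      using A that by (auto simp: points_\<xi>)
    show "f y \<in> limits \<eta> (filtermap f F)" if "y \<in> limits (small_convergence K) F" for F y
      using that \<open>f \<in> A\<close> limits_\<xi> by (simp add: \<xi>_def)
  qed
  ultimately have "{} \<in> limits \<xi> H"
    using limits_\<xi> by blast
  then have "{} \<in> adherence \<xi> H"
    using \<open>H \<noteq> bot\<close> by (auto simp: adherence_def points_\<xi> mem_proper_filters_UNIV)
  then show False
    by (simp add: \<xi>_def H_def co_small_adherence[OF K])
qed

end
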